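(* Let $\mathbb{K}$ be an algebraically closed field with a real non-Archimedean valuation $\mathrm{Val}:\mathbb{K}\to\mathbb{R}\cup\{-\infty\}$. Then the relation "$\mathrm{Val}(f)\in P_x$" between elements $f\in\mathbb{K}$ and $x\in\mathbb{T}$ is homomorphic: for any $f,g\in\mathbb{K}$ and $x,y\in\mathbb{T}$ with $\mathrm{Val}(f)\in P_x$ and $\mathrm{Val}(g)\in P_y$, we have $\mathrm{Val}(f\cdot g)\in P_{x\odot y}$ and $\mathrm{Val}(f+g)\in P_{x\oplus y}$.
   Context: Extended tropical semiring. Let $\mathbb{R}^\nu=\{a^\nu : a\in\mathbb{R}\}$ be a disjoint copy of $\mathbb{R}$, let $-\infty$ be a formal element, and put $\mathbb{T}=\mathbb{R}\cup\{-\infty\}\cup\mathbb{R}^\nu$ (disjoint union). Order $\prec$ on $\mathbb{T}$: $-\infty\prec x$ for all $x\ne-\infty$; for real $a<b$: $a\prec b$, $a\prec b^\nu$, $a^\nu\prec b$, $a^\nu\prec b^\nu$; and $a\prec a^\nu$ for all $a\in\mathbb{R}$. Addition $\oplus$: $-\infty\oplus x=x\oplus-\infty=x$; $x\oplus y=\max_\prec\{x,y\}$ if $x\neq y$; $a\oplus a=a^\nu\oplus a^\nu=a^\nu$ for $a\in\mathbb{R}$. Multiplication $\odot$: $-\infty\odot x=x\odot-\infty=-\infty$; $a\odot b=a+b$ for $a,b\in\mathbb{R}$; $a^\nu\odot b=a\odot b^\nu=a^\nu\odot b^\nu=(a+b)^\nu$. A real non-Archimedean valuation (in the max convention) is a map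 $\mathrm{Val}:\mathbb{K}\to\mathbb{R}\cup\{-\infty\}$ with $\mathrm{Val}(f)=-\infty$ if and only if $f=0$, $\mathrm{Val}(f\cdot g)=\mathrm{Val}(f)+\mathrm{Val}(g)$, and $\mathrm{Val}(f+g)\le\max\{\mathrm{Val}(f),\mathrm{Val}(g)\}$. To each element of $\mathbb{T}$ assign a subset of $\mathbb{R}\cup\{-\infty\}$: for $a\in\mathbb{R}$, $P_a=\{a\}$ and $P_{a^\nu}=[-\infty,a]=\{-\infty\}\cup(-\infty,a]$; and $P_{-\infty}=\{-\infty\}$. *)

theory Defs
  imports "HOL-Library.Extended_Real" "HOL-Computational_Algebra.Polynomial"
begin

datatype trop = MInf | Tan real | Ghost real  \<comment> \<open>\<open>Ghost a\<close> is \<open>a\<^sup>\<nu>\<close>\<close>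

instantiation trop :: linorder
begin

fun less_trop :: "trop \<Rightarrow> trop \<Rightarrow> bool" where
  "MInf < y \<longleftrightarrow> y \<noteq> MInf"
| "Tan a < MInf \<longleftrightarrow> False"
| "Ghost a < MInf \<longleftrightarrow> False"
| "Tan a < Tan b \<longleftrightarrow> a < b"
| "Tan a < Ghost b \<longleftrightarrow> a \<le> b"
| "Ghost a < Tan b \<longleftrightarrow> a < b"
| "Ghost a < Ghost b \<longleftrightarrow> a < b"

definition less_eq_trop :: "trop \<Rightarrow> trop \<Rightarrow> bool" where
  "x \<le> y \<longleftrightarrow> x < y \<or> x = (y :: trop)"

instance
proof
  fix x y z :: trop
  show "x < y \<longleftrightarrow> x \<le> y \<and> \<not> y \<le> x"
    by (cases x; cases y) (auto simp: less_eq_trop_def)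
  show "x \<le> x"
    by (simp add: less_eq_trop_def)
  show "x \<le> z" if "x \<le> y" "y \<le> z"
    using that by (cases x; cases y; cases z) (auto simp: less_eq_trop_def)
  show "x = y" if "x \<le> y" "y \<le> x"
    using that by (cases x; cases y) (auto simp: less_eq_trop_def)
  show "x \<le> y \<or> y \<le> x"
    by (cases x; cases y) (auto simp: less_eq_trop_def)
qed

end

fun ghost :: "trop \<Rightarrow> trop" where
  "ghost MInf = MInf"
| "ghost (Tan a) = Ghost a"
| "ghost (Ghost a) = Ghost a"

definition trop_add :: "trop \<Rightarrow> trop \<Rightarrow> trop" (infixl \<open>\<oplus>\<close> 65) where
  "x \<oplus> y = (if x = y then ghost x else max x y)"

fun trop_mult :: "trop \<Rightarrow> trop \<Rightarrow> trop" (infixl \<open>\<odot>\<close> 70) where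
  "MInf \<odot> y = MInf"
| "Tan a \<odot> MInf = MInf"
| "Ghost a \<odot> MInf = MInf"
| "Tan a \<odot> Tan b = Tan (a + b)"
| "Ghost a \<odot> Tan b = Ghost (a + b)"
| "Tan a \<odot> Ghost b = Ghost (a + b)"
| "Ghost a \<odot> Ghost b = Ghost (a + b)"

text \<open>The value group with bottom, \<open>\<real> \<union> {-\<infinity>}\<close>, is represented inside \<^typ>\<open>ereal\<close>,
  so the value \<open>\<infinity>\<close> has to be excluded explicitly.\<close>

definition real_valuation :: "('k :: field \<Rightarrow> ereal) \<Rightarrow> bool" where
  "real_valuation Val \<longleftrightarrow>
     (\<forall>f. Val f \<noteq> \<infinity>) \<and>
     (\<forall>f. Val f = -\<infinity> \<longleftrightarrow> f = 0) \<and>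
     (\<forall>f g. Val (f * g) = Val f + Val g) \<and>
     (\<forall>f g. Val (f + g) \<le> max (Val f) (Val g))"

text \<open>In \<^typ>\<open>ereal\<close>, \<open>{..ereal a}\<close> contains \<open>-\<infinity>\<close>, so it is \<open>[-\<infinity>, a]\<close>.\<close>

fun val_set :: "trop \<Rightarrow> ereal set" where
  "val_set MInf = {-\<infinity>}"
| "val_set (Tan a) = {ereal a}"
| "val_set (Ghost a) = {..ereal a}"

end

theory Submission
  imports Defs
begin

text \<open>
  For the product, the value of \<open>f * g\<close> is the sum of the two values, and \<open>\<odot>\<close> adds the real
  parts, so each pair of kinds of tropical elements only needs monotonicity of addition.

  For the sum, let \<open>x \<le> y\<close>, by symmetry. The ultrametric inequality bounds \<open>Val (f + g)\<close> by
  the largest value allowed by \<open>y\<close>, and this bound is all that is claimed when \<open>x \<oplus> y\<close> is a ghost.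
  It is a tangible element \<open>b\<close> only if \<open>x < y = b\<close>, and then every value allowed by \<open>x\<close> lies
  strictly below \<open>b\<close>, by the design of the order: a ghost precedes \<open>b\<close> only if its real part is smaller
  than \<open>b\<close>. So no cancellation of leading terms can occur, and \<open>Val (f + g) = b\<close> because a
  valuation of a sum with a unique dominant summand is the value of that summand
  (\<open>real_valuation_add_dominant\<close>).
\<close>

text \<open>The square of \<open>-1\<close> is \<open>1\<close>, and \<open>1\<close> is idempotent, so doubling shows that both have value \<open>0\<close>;
  the values are finite because the elements are nonzero.\<close>

lemma real_valuation_minus:
  fixes Val :: "'k :: field \<Rightarrow> ereal"
  assumes "real_valuation Val"
  shows "Val (- f) = Val f"
proof -
  have mult: "Val (u * v) = Val u + Val v" for u v
    using assms by (simp add: real_valuation_def)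
  have finite: "\<exists>r. Val u = ereal r" if "u \<noteq> 0" for u
    using assms that by (cases "Val u") (auto simp: real_valuation_def)
  obtain r s where rs: "Val 1 = ereal r" "Val (- 1) = ereal s"
    using finite[of 1] finite[of "- 1"] by auto
  have "r = r + r" "r = s + s"
    using mult[of 1 1] mult[of "- 1" "- 1"] rs by auto
  then have "Val (- 1) = 0"
    using rs by simp
  then show ?thesis
    using mult[of "- 1" f] by simp
qed

text \<open>If the value of the sum dropped below that of \<open>g\<close>, then writing \<open>g = (f + g) + (- f)\<close> would
  express \<open>g\<close> through two elements of smaller value, against the ultrametric inequality.\<close>

lemma real_valuation_add_dominant:
  fixes Val :: "'k :: field \<Rightarrow> ereal"
  assumes "real_valuation Val" and less: "Val f < Val g"
  shows "Val (f + g) = Val g"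
proof (rule antisym)
  have ultra: "Val (u + v) \<le> max (Val u) (Val v)" for u v
    using assms(1) by (simp add: real_valuation_def)
  show "Val (f + g) \<le> Val g"
    using ultra[of f g] less by (simp add: max_absorb2)
  have "Val g \<le> max (Val (f + g)) (Val f)"
    using ultra[of "f + g" "- f"] real_valuation_minus[OF assms(1)] by simp
  then show "Val g \<le> Val (f + g)"
    using less by (auto simp: le_max_iff_disj)
qed

lemma real_valuation_mult_val_set:
  fixes Val :: "'k :: field \<Rightarrow> ereal"
  assumes "real_valuation Val" "Val f \<in> val_set x" "Val g \<in> val_set y"
  shows "Val (f * g) \<in> val_set (x \<odot> y)"
proof -
  have "Val (f * g) = Val f + Val g" "Val f \<noteq> \<infinity>" "Val g \<noteq> \<infinity>"
    using assms(1) by (auto simp: real_valuation_def)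
  then show ?thesis
    using assms(2,3) by (cases x; cases y; cases "Val f"; cases "Val g") auto
qed

text \<open>The greatest value that an element allows is its real part, or \<open>-\<infinity>\<close>, and the order on
  \<open>trop\<close> compares real parts first. So the maximum of \<open>v\<close> and \<open>w\<close> is at most the greatest value
  allowed by \<open>y\<close>, and the ghost of \<open>y\<close> allows everything below that.\<close>

lemma val_set_le_ghost:
  assumes "v \<in> val_set x" "w \<in> val_set y" "x \<le> y" "u \<le> max v w"
  shows "u \<in> val_set (ghost y)"
  using assms by (cases x; cases y) (auto simp: less_eq_trop_def le_max_iff_disj intro: order_trans)

text \<open>This strictness is what rules out cancellation. It fails for a ghost on the right, where
  \<open>\<oplus>\<close> allows cancellation: \<open>Tan a < Ghost a\<close>, and both allow the value \<open>a\<close>.\<close>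

lemma val_set_less_Tan:
  assumes "v \<in> val_set x" "x < Tan b"
  shows "v < ereal b"
  using assms by (cases x) (auto intro: le_less_trans)

lemma trop_add_commute: "x \<oplus> y = y \<oplus> x"
  by (simp add: trop_add_def max.commute)

lemma real_valuation_add_val_set:
  fixes Val :: "'k :: field \<Rightarrow> ereal"
  assumes val: "real_valuation Val"
    and "Val f \<in> val_set x" "Val g \<in> val_set y"
  shows "Val (f + g) \<in> val_set (x \<oplus> y)"
  using assms(2,3)
proof (induction x y arbitrary: f g rule: linorder_wlog)
  case (le x y)
  have "Val (f + g) \<le> max (Val f) (Val g)"
    using val by (simp add: real_valuation_def)
  then have ghost: "Val (f + g) \<in> val_set (ghost y)"
    using val_set_le_ghost le by blast
  show ?case
  proof (cases "x = y")
    case True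
    then show ?thesis
      using ghost by (simp add: trop_add_def)
  next
    case False
    then have "x < y" and sum: "x \<oplus> y = y"
      using le.hyps by (auto simp: trop_add_def)
    show ?thesis
    proof (cases y)
      case (Tan b)
      then have "Val f < Val g"
        using val_set_less_Tan \<open>x < y\<close> le.prems by auto
      then show ?thesis
        using real_valuation_add_dominant[OF val] le.prems sum by simp
    qed (use ghost sum in simp_all)
  qed
next
  case (sym x y)
  then show ?case
    by (metis add.commute trop_add_commute)
qed

theorem theorem1p14:
  fixes Val :: "'k :: alg_closed_field \<Rightarrow> ereal"
    and f g :: 'k and x y :: trop
  assumes "real_valuation Val"
    and "Val f \<in> val_set x"
    and "Val g \<in> val_set y"
  shows "Val (f * g) \<in> val_set (x \<odot> y) \<and> Val (f + g) \<in> val_set (x \<oplus> y)"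
  using real_valuation_mult_val_set[OF assms] real_valuation_add_val_set[OF assms] ..

end
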